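(* Let $i<j<k$ be indices in $\{1,\dots,n\}$ and consider the following inequalities in $(x,Y)$: (T19) $\ell_iY_{jk} + (u_j - \ell_j)Y_{ik} - \ell_iu_kx_j + u_k(\ell_j- u_j)x_i - \ell_iu_jx_k + \ell_iu_ju_k \leq 0$; (T20) $(u_k - \ell_k)Y_{ij} + \ell_iY_{jk} - \ell_iu_kx_j +u_j(\ell_k - u_k)x_i - \ell_iu_jx_k + \ell_iu_ju_k \leq 0$; (T21) $u_jY_{ik} - u_ju_kx_i - \ell_iu_jx_k + \ell_iu_ju_k \leq 0$; (T22) $u_kY_{ij} - \ell_iu_kx_j - u_ju_kx_i + \ell_iu_ju_k \leq 0$; (T23) $(u_k - \ell_k)Y_{ij} + (\ell_i - u_i) Y_{jk} + u_jY_{ik} +(u_i\ell_k - \ell_iu_k)x_j - u_ju_kx_i - \ell_iu_jx_k + \ell_iu_ju_k \leq 0$; (T24) $u_kY_{ij} + (\ell_i - u_i) Y_{jk} + (u_j - \ell_j)Y_{ik} - \ell_iu_kx_j - u_ju_kx_i + (u_i\ell_j - \ell_iu_j) x_k + \ell_iu_ju_k \leq 0$. Then (T23) and (T24) cut feasible solutions of $(P_{S_0,\ldots,S_m})$ (that is, each of them is violated by some feasible solution of $(P_{S_0,\ldots,S_m})$), while (T19), (T20), (T21) and (T22) are redundant for $(P_{S_0,\ldots,S_m})$ (that is, they are satisfied by every feasible solution of it).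
   Context: Problem $(P)$ is: minimize $\langle Q_0,xx^T\rangle+c_0^Tx$ over $x\in\mathbb{R}^n$ subject to $\langle Q_r,xx^T\rangle+c_r^Tx\le b_r$ for $r=1,\dots,m$ and $\ell_p\le x_p\le u_p$ for $p=1,\dots,n$. Here $Q_0,\dots,Q_m$ are symmetric $n\times n$ real matrices, $c_0,\dots,c_m\in\mathbb{R}^n$, $b\in\mathbb{R}^m$, $u\in\mathbb{R}^n$, $\ell\in\mathbb{R}_+^n$, the feasible domain of $(P)$ is assumed non-empty, and $\langle A,B\rangle=\sum_{p,q}a_{pq}b_{pq}$. Let $S_0,\dots,S_m$ be any symmetric positive semidefinite $n\times n$ matrices. The convex relaxation $(P_{S_0,\ldots,S_m})$ of $(P)$ is the problem of minimizing $\langle S_0,xx^T\rangle+c_0^Tx+\langle Q_0-S_0,Y\rangle$ over $(x,Y)\in\mathbb{R}^n\times\mathbb{R}^{n\times n}$ subject to: - $\ell_p\le x_p\le u_p$ for all $p$; - $\langle S_r,xx^T\rangle+c_r^Tx+\langle Q_r-S_r,Y\rangle\le b_r$ for $r=1,\dots,m$; - $Y_{qp}=Y_{pq}$ for all $p<q$; - the McCormick inequalities, for all $1\le p\le q\le n$: $Y_{pq}-u_qx_p-\ell_px_q+u_q\ell_p\le 0$, $Y_{pq}-u_px_q-\ell_qx_p+u_p\ell_q\le 0$, $-Y_{pq}+u_qx_p+u_px_q-u_pu_q\le 0$, $-Y_{pq}+\ell_qx_p+\ell_px_q-\ell_p\ell_q\le 0$.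
   Formalization: The claim that (T23) and (T24) cut feasible solutions fails for some instances (e.g. ℓ=u, or constraints forcing x=ℓ); it is proved when ℓ≤u, with ℓ<u in coordinates i,j,k, and all b_r sufficiently large (any b if m=0). *)

theory Defs
  imports "HOL-Analysis.Analysis"
begin

text \<open>
  The dimension is the cardinality of a finite linearly ordered index type \<open>'n\<close>, so that
  \<open>p < q\<close> on indices makes sense. The matrix inner product \<open>\<langle>A,B\<rangle>\<close> is the library's inner product
  on \<open>real^'n^'n\<close>, see \<open>matrix_inner_eq_sum\<close>. Families indexed by \<open>r = 0,\<dots>,m\<close> are functions on
  \<open>nat\<close>; index 0 carries the objective. Only the feasible domains of the two minimization problems
  are defined, since redundancy and cutting depend on nothing else.
\<close>

lemma matrix_inner_eq_sum:
  fixes A B :: "real ^ 'n::finite ^ 'm::finite"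
  shows "A \<bullet> B = (\<Sum>p\<in>UNIV. \<Sum>q\<in>UNIV. A $ p $ q * B $ p $ q)"
  by (simp add: inner_vec_def)

definition outer :: "real ^ 'n \<Rightarrow> real ^ 'n ^ 'n" where
  "outer x = (\<chi> p q. x $ p * x $ q)"

definition symmetric_mat :: "real ^ 'n ^ 'n \<Rightarrow> bool" where
  "symmetric_mat A \<longleftrightarrow> transpose A = A"

definition psd :: "real ^ 'n ^ 'n \<Rightarrow> bool" where
  "psd A \<longleftrightarrow> symmetric_mat A \<and> (\<forall>x. 0 \<le> x \<bullet> (A *v x))"

definition P_domain ::
    "nat \<Rightarrow> (nat \<Rightarrow> real ^ 'n ^ 'n) \<Rightarrow> (nat \<Rightarrow> real ^ 'n) \<Rightarrow> (nat \<Rightarrow> real) \<Rightarrow>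
     real ^ 'n \<Rightarrow> real ^ 'n \<Rightarrow> (real ^ 'n) set" where
  "P_domain m Q c b l u =
     {x. (\<forall>r\<in>{1..m}. Q r \<bullet> outer x + c r \<bullet> x \<le> b r) \<and>
         (\<forall>p. l $ p \<le> x $ p \<and> x $ p \<le> u $ p)}"

definition McCormick :: "real ^ 'n \<Rightarrow> real ^ 'n \<Rightarrow> real ^ 'n \<Rightarrow> real ^ 'n ^ 'n \<Rightarrow> 'n \<Rightarrow> 'n \<Rightarrow> bool" where
  "McCormick l u x Y p q \<longleftrightarrow>
     Y $ p $ q - u $ q * x $ p - l $ p * x $ q + u $ q * l $ p \<le> 0 \<and>
     Y $ p $ q - u $ p * x $ q - l $ q * x $ p + u $ p * l $ q \<le> 0 \<and>
     - (Y $ p $ q) + u $ q * x $ p + u $ p * x $ q - u $ p * u $ q \<le> 0 \<and>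
     - (Y $ p $ q) + l $ q * x $ p + l $ p * x $ q - l $ p * l $ q \<le> 0"

definition PS_domain ::
    "nat \<Rightarrow> (nat \<Rightarrow> real ^ 'n::{finite,linorder} ^ 'n::{finite,linorder}) \<Rightarrow> (nat \<Rightarrow> real ^ 'n::{finite,linorder}) \<Rightarrow> (nat \<Rightarrow> real) \<Rightarrow>
     real ^ 'n::{finite,linorder} \<Rightarrow> real ^ 'n::{finite,linorder} \<Rightarrow> (nat \<Rightarrow> real ^ 'n::{finite,linorder} ^ 'n::{finite,linorder}) \<Rightarrow>
     ((real ^ 'n::{finite,linorder}) \<times> (real ^ 'n::{finite,linorder} ^ 'n::{finite,linorder})) set" where
  "PS_domain m Q c b l u S =
     {(x, Y). (\<forall>p. l $ p \<le> x $ p \<and> x $ p \<le> u $ p) \<and>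
              (\<forall>r\<in>{1..m}. S r \<bullet> outer x + c r \<bullet> x + (Q r - S r) \<bullet> Y \<le> b r) \<and>
              (\<forall>p q. p < q \<longrightarrow> Y $ q $ p = Y $ p $ q) \<and>
              (\<forall>p q. p \<le> q \<longrightarrow> McCormick l u x Y p q)}"

type_synonym 'n ineq = "real ^ 'n \<Rightarrow> real ^ 'n ^ 'n \<Rightarrow> bool"

text \<open>
  Whether an inequality cuts the relaxation depends on the instance: none of those below does if
  \<open>l = u\<close>, or if the constraints force \<open>x = l\<close>. A claim about \<open>cuts\<close> therefore needs a box that is
  nondegenerate in the coordinates involved and right-hand sides \<open>b\<close> that are large enough.
\<close>

definition redundant_for :: "'n ineq \<Rightarrow> ((real ^ 'n) \<times> (real ^ 'n ^ 'n)) set \<Rightarrow> bool" where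
  "redundant_for T F \<longleftrightarrow> (\<forall>(x, Y)\<in>F. T x Y)"

definition cuts :: "'n ineq \<Rightarrow> ((real ^ 'n) \<times> (real ^ 'n ^ 'n)) set \<Rightarrow> bool" where
  "cuts T F \<longleftrightarrow> (\<exists>(x, Y)\<in>F. \<not> T x Y)"

definition T19 :: "real ^ 'n \<Rightarrow> real ^ 'n \<Rightarrow> 'n \<Rightarrow> 'n \<Rightarrow> 'n \<Rightarrow> 'n ineq" where
  "T19 l u i j k x Y \<longleftrightarrow>
     l $ i * Y $ j $ k + (u $ j - l $ j) * Y $ i $ k - l $ i * u $ k * x $ j
     + u $ k * (l $ j - u $ j) * x $ i - l $ i * u $ j * x $ k + l $ i * u $ j * u $ k \<le> 0"

definition T20 :: "real ^ 'n \<Rightarrow> real ^ 'n \<Rightarrow> 'n \<Rightarrow> 'n \<Rightarrow> 'n \<Rightarrow> 'n ineq" where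
  "T20 l u i j k x Y \<longleftrightarrow>
     (u $ k - l $ k) * Y $ i $ j + l $ i * Y $ j $ k - l $ i * u $ k * x $ j
     + u $ j * (l $ k - u $ k) * x $ i - l $ i * u $ j * x $ k + l $ i * u $ j * u $ k \<le> 0"

definition T21 :: "real ^ 'n \<Rightarrow> real ^ 'n \<Rightarrow> 'n \<Rightarrow> 'n \<Rightarrow> 'n \<Rightarrow> 'n ineq" where
  "T21 l u i j k x Y \<longleftrightarrow>
     u $ j * Y $ i $ k - u $ j * u $ k * x $ i - l $ i * u $ j * x $ k
     + l $ i * u $ j * u $ k \<le> 0"

definition T22 :: "real ^ 'n \<Rightarrow> real ^ 'n \<Rightarrow> 'n \<Rightarrow> 'n \<Rightarrow> 'n \<Rightarrow> 'n ineq" where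
  "T22 l u i j k x Y \<longleftrightarrow>
     u $ k * Y $ i $ j - l $ i * u $ k * x $ j - u $ j * u $ k * x $ i
     + l $ i * u $ j * u $ k \<le> 0"

definition T23 :: "real ^ 'n \<Rightarrow> real ^ 'n \<Rightarrow> 'n \<Rightarrow> 'n \<Rightarrow> 'n \<Rightarrow> 'n ineq" where
  "T23 l u i j k x Y \<longleftrightarrow>
     (u $ k - l $ k) * Y $ i $ j + (l $ i - u $ i) * Y $ j $ k + u $ j * Y $ i $ k
     + (u $ i * l $ k - l $ i * u $ k) * x $ j - u $ j * u $ k * x $ i
     - l $ i * u $ j * x $ k + l $ i * u $ j * u $ k \<le> 0"

definition T24 :: "real ^ 'n \<Rightarrow> real ^ 'n \<Rightarrow> 'n \<Rightarrow> 'n \<Rightarrow> 'n \<Rightarrow> 'n ineq" where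
  "T24 l u i j k x Y \<longleftrightarrow>
     u $ k * Y $ i $ j + (l $ i - u $ i) * Y $ j $ k + (u $ j - l $ j) * Y $ i $ k
     - l $ i * u $ k * x $ j - u $ j * u $ k * x $ i
     + (u $ i * l $ j - l $ i * u $ j) * x $ k + l $ i * u $ j * u $ k \<le> 0"

end

theory Submission
  imports Defs
begin

text \<open>
  Write \<open>M\<^sub>p\<^sub>q = Y\<^sub>p\<^sub>q - u\<^sub>q x\<^sub>p - \<ell>\<^sub>p x\<^sub>q + u\<^sub>q \<ell>\<^sub>p\<close> and
  \<open>M'\<^sub>p\<^sub>q = Y\<^sub>p\<^sub>q - u\<^sub>p x\<^sub>q - \<ell>\<^sub>q x\<^sub>p + u\<^sub>p \<ell>\<^sub>q\<close> for the left-hand sides of the first two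
  McCormick inequalities, and \<open>d = u - \<ell>\<close>.

  The left-hand sides of (T19) to (T22) are combinations of these with nonnegative coefficients,
  namely \<open>d\<^sub>j M\<^sub>i\<^sub>k + \<ell>\<^sub>i M\<^sub>j\<^sub>k\<close>, \<open>d\<^sub>k M\<^sub>i\<^sub>j + \<ell>\<^sub>i M'\<^sub>j\<^sub>k\<close>, \<open>u\<^sub>j M\<^sub>i\<^sub>k\<close> and \<open>u\<^sub>k M\<^sub>i\<^sub>j\<close>. Hence the four
  inequalities follow from the McCormick inequalities (\<open>T19_T22_if_McCormick\<close>).

  The other two are different because they contain a triangle inequality of the Boolean quadric
  polytope. When \<open>d\<^sub>i\<close>, \<open>d\<^sub>j\<close>, \<open>d\<^sub>k\<close> are positive, rescale the box in these coordinates to the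
  unit cube, with \<open>s\<^sub>p\<close> for \<open>x\<^sub>p\<close> and \<open>w\<^sub>p\<^sub>q\<close> for the
  linearized product, and let \<open>\<Delta> = w\<^sub>i\<^sub>j + w\<^sub>i\<^sub>k - w\<^sub>j\<^sub>k - s\<^sub>i\<close>. Then the left-hand sides of (T23) and
  (T24) are \<open>d\<^sub>i d\<^sub>j d\<^sub>k \<Delta> + \<ell>\<^sub>j M'\<^sub>i\<^sub>k\<close> and \<open>d\<^sub>i d\<^sub>j d\<^sub>k \<Delta> + \<ell>\<^sub>k M'\<^sub>i\<^sub>j\<close>. The McCormick inequalities bound
  each product separately, so at the centre of the cube they allow \<open>w\<^sub>i\<^sub>j = w\<^sub>i\<^sub>k = 1/2\<close> together
  with \<open>w\<^sub>j\<^sub>k = 0\<close>. There \<open>\<Delta> = 1/2\<close>, while \<open>M'\<^sub>i\<^sub>j = M'\<^sub>i\<^sub>k = 0\<close>; so this one point violates both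
  inequalities by \<open>d\<^sub>i d\<^sub>j d\<^sub>k / 2\<close> (\<open>T23_T24_fail_at_centre\<close>). It satisfies the remaining
  constraints once the right-hand sides \<open>b\<close> are large enough.
\<close>

lemma T19_T22_if_McCormick:
  fixes l u x :: "real ^ 'n" and Y :: "real ^ 'n ^ 'n"
  assumes l: "0 \<le> l $ i" and lu: "l $ j \<le> u $ j" "l $ k \<le> u $ k"
    and u: "0 \<le> u $ j" "0 \<le> u $ k"
    and ij: "McCormick l u x Y i j" and ik: "McCormick l u x Y i k"
    and jk: "McCormick l u x Y j k"
  shows "T19 l u i j k x Y" "T20 l u i j k x Y" "T21 l u i j k x Y" "T22 l u i j k x Y"
proof -
  let ?M = "\<lambda>p q. Y $ p $ q - u $ q * x $ p - l $ p * x $ q + u $ q * l $ p"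
  let ?M' = "\<lambda>p q. Y $ p $ q - u $ p * x $ q - l $ q * x $ p + u $ p * l $ q"
  have M: "?M i j \<le> 0" "?M i k \<le> 0" "?M j k \<le> 0" "?M' j k \<le> 0"
    using ij ik jk by (auto simp: McCormick_def)
  have scale: "a * t \<le> 0" if "0 \<le> a" "t \<le> 0" for a t :: real
    using that by (rule mult_nonneg_nonpos)
  have "(u $ j - l $ j) * ?M i k + l $ i * ?M j k \<le> 0"
    using scale[OF _ M(2), of "u $ j - l $ j"] scale[OF l M(3)] lu by linarith
  then show "T19 l u i j k x Y"
    unfolding T19_def by (simp add: algebra_simps)
  have "(u $ k - l $ k) * ?M i j + l $ i * ?M' j k \<le> 0"
    using scale[OF _ M(1), of "u $ k - l $ k"] scale[OF l M(4)] lu by linarith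
  then show "T20 l u i j k x Y"
    unfolding T20_def by (simp add: algebra_simps)
  show "T21 l u i j k x Y"
    using scale[OF u(1) M(2)] unfolding T21_def by (simp add: algebra_simps)
  show "T22 l u i j k x Y"
    using scale[OF u(2) M(1)] unfolding T22_def by (simp add: algebra_simps)
qed

definition box_centre :: "real ^ 'n \<Rightarrow> real ^ 'n \<Rightarrow> real ^ 'n" where
  "box_centre l u = (\<chi> p. (l $ p + u $ p) / 2)"

text \<open>
  At the centre of the box, the McCormick inequalities confine \<open>Y\<^sub>p\<^sub>q\<close> to an interval of length
  \<open>d\<^sub>p d\<^sub>q / 2\<close>. The matrix below takes the lower end at the positions \<open>(j,k)\<close> and \<open>(k,j)\<close>, and
  the upper end at all others.
\<close>

definition triangle_violating_mat ::
    "real ^ 'n \<Rightarrow> real ^ 'n \<Rightarrow> 'n \<Rightarrow> 'n \<Rightarrow> real ^ 'n ^ 'n" where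
  "triangle_violating_mat l u j k =
     (\<chi> p q. if {p, q} = {j, k} then (l $ p * u $ q + u $ p * l $ q) / 2
             else (l $ p * l $ q + u $ p * u $ q) / 2)"

lemma triangle_violating_mat_sym:
  "triangle_violating_mat l u j k $ q $ p = triangle_violating_mat l u j k $ p $ q"
  by (simp add: triangle_violating_mat_def insert_commute algebra_simps)

lemma McCormick_at_centre:
  assumes "l $ p \<le> u $ p" and "l $ q \<le> u $ q"
  shows "McCormick l u (box_centre l u) (triangle_violating_mat l u j k) p q"
proof -
  \<comment> \<open>This product is twice the length of the interval of admissible values.\<close>
  have "0 \<le> (u $ p - l $ p) * (u $ q - l $ q)"
    using assms by simp
  then show ?thesis
    by (cases "{p, q} = {j, k}")
      (simp_all add: McCormick_def box_centre_def triangle_violating_mat_def field_simps)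
qed

text \<open>
  Distinctness matters here: (T23) and (T24) need \<open>Y\<^sub>i\<^sub>j\<close> and \<open>Y\<^sub>i\<^sub>k\<close> at their upper ends, and
  \<open>i \<noteq> j\<close>, \<open>i \<noteq> k\<close> keep these positions apart from \<open>(j,k)\<close>.
\<close>

lemma T23_T24_fail_at_centre:
  assumes "i \<noteq> j" and "i \<noteq> k"
    and "l $ i < u $ i" and "l $ j < u $ j" and "l $ k < u $ k"
  shows "\<not> T23 l u i j k (box_centre l u) (triangle_violating_mat l u j k)"
    and "\<not> T24 l u i j k (box_centre l u) (triangle_violating_mat l u j k)"
proof -
  have violation: "0 < (u $ i - l $ i) * (u $ j - l $ j) * (u $ k - l $ k)"
    using assms by simp
  have ne: "{i, j} \<noteq> {j, k}" "{i, k} \<noteq> {j, k}"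
    using assms(1,2) by auto
  show "\<not> T23 l u i j k (box_centre l u) (triangle_violating_mat l u j k)"
    using violation ne
    by (simp add: T23_def box_centre_def triangle_violating_mat_def field_simps)
  show "\<not> T24 l u i j k (box_centre l u) (triangle_violating_mat l u j k)"
    using violation ne
    by (simp add: T24_def box_centre_def triangle_violating_mat_def field_simps)
qed

theorem proposition4:
  fixes m :: nat
    and Q S :: "nat \<Rightarrow> real ^ 'n::{finite,linorder} ^ 'n::{finite,linorder}"
    and c :: "nat \<Rightarrow> real ^ 'n::{finite,linorder}"
    and l u :: "real ^ 'n::{finite,linorder}"
    and i j k :: "'n::{finite,linorder}"
  assumes "\<forall>r\<in>{0..m}. symmetric_mat (Q r)"
    and "\<forall>r\<in>{0..m}. psd (S r)"
    and "\<forall>p. 0 \<le> l $ p"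
    and "i < j" and "j < k"
  shows "(\<forall>b. P_domain m Q c b l u \<noteq> {} \<longrightarrow>
            redundant_for (T19 l u i j k) (PS_domain m Q c b l u S) \<and>
            redundant_for (T20 l u i j k) (PS_domain m Q c b l u S) \<and>
            redundant_for (T21 l u i j k) (PS_domain m Q c b l u S) \<and>
            redundant_for (T22 l u i j k) (PS_domain m Q c b l u S))
       \<and> ((\<forall>p. l $ p \<le> u $ p) \<and> l $ i < u $ i \<and> l $ j < u $ j \<and> l $ k < u $ k \<longrightarrow>
            (\<exists>b0. \<forall>b. (\<forall>r\<in>{1..m}. b0 r \<le> b r) \<longrightarrow>
               P_domain m Q c b l u \<noteq> {} \<and>
               cuts (T23 l u i j k) (PS_domain m Q c b l u S) \<and>
               cuts (T24 l u i j k) (PS_domain m Q c b l u S)))"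
proof (intro conjI allI impI)
  fix b
  have "T19 l u i j k x Y \<and> T20 l u i j k x Y \<and> T21 l u i j k x Y \<and> T22 l u i j k x Y"
    if "(x, Y) \<in> PS_domain m Q c b l u S" for x Y
  proof -
    have box: "l $ p \<le> u $ p" for p
      using that by (auto simp: PS_domain_def intro: order_trans)
    moreover have "0 \<le> u $ p" for p
      using box[of p] assms(3) by (meson order_trans)
    moreover have "McCormick l u x Y p q" if "p < q" for p q
      using \<open>(x, Y) \<in> PS_domain m Q c b l u S\<close> that by (simp add: PS_domain_def)
    ultimately show ?thesis
      using assms(3-5) T19_T22_if_McCormick[of l i j u k x Y] by (metis less_trans)
  qed
  then show "redundant_for (T19 l u i j k) (PS_domain m Q c b l u S)"
    and "redundant_for (T20 l u i j k) (PS_domain m Q c b l u S)"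
    and "redundant_for (T21 l u i j k) (PS_domain m Q c b l u S)"
    and "redundant_for (T22 l u i j k) (PS_domain m Q c b l u S)"
    by (auto simp: redundant_for_def)
next
  assume lu: "(\<forall>p. l $ p \<le> u $ p) \<and> l $ i < u $ i \<and> l $ j < u $ j \<and> l $ k < u $ k"
  define x where "x = box_centre l u"
  define Y where "Y = triangle_violating_mat l u j k"
  \<comment> \<open>The two terms make the centre feasible for the original problem and for the relaxation.\<close>
  define b0 where "b0 r = max (Q r \<bullet> outer x + c r \<bullet> x)
      (S r \<bullet> outer x + c r \<bullet> x + (Q r - S r) \<bullet> Y)" for r
  have box: "l $ p \<le> x $ p \<and> x $ p \<le> u $ p" for p
    using lu spec[of "\<lambda>p. l $ p \<le> u $ p" p] by (simp add: x_def box_centre_def)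
  have cut: "\<not> T23 l u i j k x Y" "\<not> T24 l u i j k x Y"
    using T23_T24_fail_at_centre[of i j k l u] lu assms(4,5) by (auto simp: x_def Y_def)
  have "P_domain m Q c b l u \<noteq> {} \<and>
      cuts (T23 l u i j k) (PS_domain m Q c b l u S) \<and>
      cuts (T24 l u i j k) (PS_domain m Q c b l u S)"
    if b: "\<forall>r\<in>{1..m}. b0 r \<le> b r" for b
  proof -
    have "x \<in> P_domain m Q c b l u"
      using b box by (auto simp: P_domain_def b0_def)
    moreover have "(x, Y) \<in> PS_domain m Q c b l u S"
      using b box lu
      by (auto simp: PS_domain_def b0_def x_def Y_def
          intro: McCormick_at_centre triangle_violating_mat_sym)
    ultimately show ?thesis
      using cut by (auto simp: cuts_def)
  qed
  then show "\<exists>b0. \<forall>b. (\<forall>r\<in>{1..m}. b0 r \<le> b r) \<longrightarrow>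
      P_domain m Q c b l u \<noteq> {} \<and>
      cuts (T23 l u i j k) (PS_domain m Q c b l u S) \<and>
      cuts (T24 l u i j k) (PS_domain m Q c b l u S)"
    by blast
qed

end
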